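(* Every connected locally connected $\{K_1+P_4,\,K_{1,4},\,K_2+(K_1\cup K_2)\}$-free graph of order at least $3$ that is distinct from (i.e. not isomorphic to) $K_{1,1,3}$ is fully cycle extendable.
   Context: All graphs are finite, simple, and undirected. $n(G)$ is the order of $G$; $N_G(u)$ is the (open) neighborhood of $u$ in $G$. $G$ is locally connected if for every vertex $u$ of $G$ the induced subgraph $G[N_G(u)]$ is connected. For disjoint graphs $G,H$, $G\cup H$ is their disjoint union and $G+H$ their join (all edges between $G$ and $H$ are added to $G\cup H$); $K_n$ and $P_n$ are the complete graph and the path of order $n$, $\bar{G}$ is the complement of $G$, $K_{1,4}=K_1+\bar{K}_4$ is the star of order $5$, and $K_{1,1,3}=K_1+K_1+\bar{K}_3$. For a set ${\cal F}$ of graphs, a graph is ${\cal F}$-free if it contains no graph in ${\cal F}$ as an induced subgraph (up to isomorphism). A cycle $C$ in $G$ is extendable if $G$ contains a cycle $C'$ of order $n(C)+1$ with $V(C)\subseteq V(C')$. $G$ is fully cycle extendable if every vertex of $G$ lies on a triangle and every cycle in $G$ of order less than $n(G)$ is extendable. *)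

theory Defs
  imports "Graph_Theory.Graph_Theory"
begin

text \<open>
  Finite simple undirected graphs are the \<^locale>\<open>pair_graph\<close> structures of the AFP entry
  Graph_Theory: finite, loop-free, symmetric sets of pairs, each undirected edge being represented
  by both of its orientations.
\<close>

definition neighborhood :: "'a pair_pre_digraph \<Rightarrow> 'a \<Rightarrow> 'a set" where
  "neighborhood G u = {v. (u, v) \<in> parcs G}"

text \<open>
  \<^const>\<open>connected\<close> requires a nonempty vertex set, so the neighborhood of an isolated vertex
  does not count as connected.
\<close>

definition locally_connected :: "'a pair_pre_digraph \<Rightarrow> bool" where
  "locally_connected G \<longleftrightarrow>
     (\<forall>u \<in> pverts G. connected (with_proj G \<restriction> neighborhood G u))"

definition complete_graph :: "nat \<Rightarrow> nat pair_pre_digraph" where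
  "complete_graph n = \<lparr> pverts = {..<n}, parcs = {(i, j). i < n \<and> j < n \<and> i \<noteq> j} \<rparr>"

definition path_graph :: "nat \<Rightarrow> nat pair_pre_digraph" where
  "path_graph n =
     \<lparr> pverts = {..<n}, parcs = {(i, j). i < n \<and> j < n \<and> (j = Suc i \<or> i = Suc j)} \<rparr>"

definition graph_complement :: "'a pair_pre_digraph \<Rightarrow> 'a pair_pre_digraph" where
  "graph_complement G =
     \<lparr> pverts = pverts G,
       parcs = {(u, v). u \<in> pverts G \<and> v \<in> pverts G \<and> u \<noteq> v \<and> (u, v) \<notin> parcs G} \<rparr>"

text \<open>
  The sum type makes the two vertex sets disjoint, so both operations are meaningful for arbitrary
  arguments. (The constant \<^const>\<open>union\<close> of the library, in contrast, glues along common
  vertices.)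
\<close>

definition disjoint_union ::
  "'a pair_pre_digraph \<Rightarrow> 'b pair_pre_digraph \<Rightarrow> ('a + 'b) pair_pre_digraph" where
  "disjoint_union G H =
     \<lparr> pverts = pverts G <+> pverts H,
       parcs = map_prod Inl Inl ` parcs G \<union> map_prod Inr Inr ` parcs H \<rparr>"

definition graph_join ::
  "'a pair_pre_digraph \<Rightarrow> 'b pair_pre_digraph \<Rightarrow> ('a + 'b) pair_pre_digraph" where
  "graph_join G H =
     \<lparr> pverts = pverts G <+> pverts H,
       parcs = parcs (disjoint_union G H)
         \<union> (Inl ` pverts G) \<times> (Inr ` pverts H) \<union> (Inr ` pverts H) \<times> (Inl ` pverts G) \<rparr>"

definition K1_join_P4 :: "(nat + nat) pair_pre_digraph" where
  "K1_join_P4 = graph_join (complete_graph 1) (path_graph 4)"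

definition K14 :: "(nat + nat) pair_pre_digraph" where
  "K14 = graph_join (complete_graph 1) (graph_complement (complete_graph 4))"

definition K2_join_K1_K2 :: "(nat + (nat + nat)) pair_pre_digraph" where
  "K2_join_K1_K2 =
     graph_join (complete_graph 2) (disjoint_union (complete_graph 1) (complete_graph 2))"

definition K113 :: "((nat + nat) + nat) pair_pre_digraph" where
  "K113 = graph_join (graph_join (complete_graph 1) (complete_graph 1))
            (graph_complement (complete_graph 3))"

text \<open>
  The graphs of a forbidden family may have different vertex types; being free of the family is
  therefore expressed as the conjunction over its members.
\<close>

definition induced_free :: "'a pair_pre_digraph \<Rightarrow> 'b pair_pre_digraph \<Rightarrow> bool" where
  "induced_free G F \<longleftrightarrow>
     \<not> (\<exists>H. induced_subgraph H (with_proj G) \<and> digraph_iso H (with_proj F))"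

text \<open>
  The library's \<^const>\<open>pre_digraph.cycle\<close> is a nonempty closed walk, given by its list of arcs,
  without repeated vertices except for the endpoints. In a symmetric digraph this admits the
  2-cycles u, v, u, which are not cycles of the undirected graph.
\<close>

definition graph_cycle :: "'a pair_pre_digraph \<Rightarrow> ('a \<times> 'a) list \<Rightarrow> bool" where
  "graph_cycle G C \<longleftrightarrow> pre_digraph.cycle (with_proj G) C \<and> 3 \<le> length C"

definition cycle_verts :: "('a \<times> 'a) list \<Rightarrow> 'a set" where
  "cycle_verts C = fst ` set C"

definition extendable :: "'a pair_pre_digraph \<Rightarrow> ('a \<times> 'a) list \<Rightarrow> bool" where
  "extendable G C \<longleftrightarrow>
     (\<exists>C'. graph_cycle G C' \<and> card (cycle_verts C') = card (cycle_verts C) + 1 \<and>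
           cycle_verts C \<subseteq> cycle_verts C')"

definition fully_cycle_extendable :: "'a pair_pre_digraph \<Rightarrow> bool" where
  "fully_cycle_extendable G \<longleftrightarrow>
     (\<forall>u \<in> pverts G. \<exists>T. graph_cycle G T \<and> card (cycle_verts T) = 3 \<and> u \<in> cycle_verts T) \<and>
     (\<forall>C. graph_cycle G C \<and> card (cycle_verts C) < card (pverts G) \<longrightarrow> extendable G C)"

lemma graph_cycle_order:
  assumes "graph_cycle G C"
  shows "card (cycle_verts C) = length C"
proof -
  have tl_eq: "tl (pawalk_verts u p) = map snd p \<and> fst ` set p = set (map snd p)"
    if "pcas u p u" for u and p :: "('a \<times> 'a) list"
  proof -
    have 1: "pawalk_verts v q = v # map snd q" if "pcas v q w" for v w q
      using that by (induction q arbitrary: v) auto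
    have 2: "insert w (fst ` set q) = insert v (snd ` set q)" if "pcas v q w"
      for v w :: 'a and q
      using that by (induction q arbitrary: v) auto
    have 3: "u \<in> fst ` set p \<and> u \<in> snd ` set p" if "p \<noteq> []"
    proof -
      have 4: "w \<in> snd ` set q" if "pcas v q w" "q \<noteq> []" for v w :: 'a and q
        using that by (induction q arbitrary: v) (auto, metis pcas.simps(1))
      have "u \<in> fst ` set p" using \<open>pcas u p u\<close> that by (cases p) auto
      with 4[OF \<open>pcas u p u\<close> that] show ?thesis by simp
    qed
    show ?thesis
      using 1[OF that] 2[OF that] 3 by (cases "p = []") (auto simp: insert_absorb)
  qed
  from assms obtain u where "pcas u C u" and "distinct (tl (pawalk_verts u C))"
    by (auto simp: graph_cycle_def pre_digraph.cycle_def pre_digraph.awalk_def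
        cas_with_proj_eq awalk_verts_with_proj_eq)
  then show ?thesis
    using tl_eq by (metis cycle_verts_def distinct_card length_map)
qed

lemma pair_graph_iff:
  "pair_graph G \<longleftrightarrow> finite (pverts G) \<and> parcs G \<subseteq> pverts G \<times> pverts G \<and> sym (parcs G) \<and> irrefl (parcs G)"
proof
  assume "pair_graph G"
  then interpret pair_graph G .
  show "finite (pverts G) \<and> parcs G \<subseteq> pverts G \<times> pverts G \<and> sym (parcs G) \<and> irrefl (parcs G)"
    using pair_finite_verts pair_sym_arcs pair_no_loops wellformed'
    by (fastforce simp: symmetric_def irrefl_def)
next
  assume *: "finite (pverts G) \<and> parcs G \<subseteq> pverts G \<times> pverts G \<and> sym (parcs G) \<and> irrefl (parcs G)"
  then have "finite (parcs G)"
    by (meson finite_SigmaI finite_subset)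
  with * show "pair_graph G"
    by unfold_locales (auto simp: symmetric_def irrefl_def)
qed

lemma pair_graph_complete_graph: "pair_graph (complete_graph n)"
  by (auto simp: pair_graph_iff complete_graph_def sym_def irrefl_def)

lemma pair_graph_path_graph: "pair_graph (path_graph n)"
  by (auto simp: pair_graph_iff path_graph_def sym_def irrefl_def)

lemma pair_graph_complement: "pair_graph G \<Longrightarrow> pair_graph (graph_complement G)"
  by (auto simp: pair_graph_iff graph_complement_def sym_def irrefl_def)

lemma pair_graph_disjoint_union:
  "pair_graph G \<Longrightarrow> pair_graph H \<Longrightarrow> pair_graph (disjoint_union G H)"
  unfolding pair_graph_iff disjoint_union_def sym_def irrefl_def by fastforce

lemma pair_graph_join:
  "pair_graph G \<Longrightarrow> pair_graph H \<Longrightarrow> pair_graph (graph_join G H)"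
  unfolding pair_graph_iff graph_join_def disjoint_union_def sym_def irrefl_def by fastforce

end

theory Submission
  imports Defs
begin

text \<open>
  Suppose that a cycle C is not extendable, that u lies on C and that x is a neighbor of u outside C.
  As N(u) is connected and induces no P4, any vertex of N(u) with two non-neighbors in N(u) shares a
  neighbor in N(u) with both of them. Applied to x and the two cycle neighbors of u, this yields a
  vertex v adjacent to u, x and both cycle neighbors of u, and v lies on C since otherwise it could
  be inserted. The same holds at v, and no edge joins the two successors or the two predecessors of
  u and v. Excluding K1,4 and K1 + P4 at v makes u and v adjacent to all cycle neighbors of either,
  and then excluding K2 + (K1 u K2) on the edge uv forces these to coincide, so that C has length 4
  and C together with x induces K1,1,3. A further vertex would create K1,4 or K2 + (K1 u K2) again.
\<close>

section \<open>Isomorphisms and induced subgraphs of pair graphs\<close>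

lemma digraph_isoI:
  fixes F :: "'b pair_pre_digraph" and G :: "'a pair_pre_digraph"
  assumes "pair_wf_digraph G" "pair_wf_digraph F"
    and inj: "inj_on f (pverts F)" and verts: "f ` pverts F = pverts G"
    and arcs: "\<And>i j. i \<in> pverts F \<Longrightarrow> j \<in> pverts F \<Longrightarrow> (f i, f j) \<in> parcs G \<longleftrightarrow> (i, j) \<in> parcs F"
  shows "digraph_iso (with_proj G) (with_proj F)"
proof -
  interpret G: pair_wf_digraph G by fact
  interpret F: pair_wf_digraph F by fact
  \<comment> \<open>\<open>digraph_iso\<close> asks for a map out of the first graph, hence the
    inverse of \<open>f\<close>. An arc is the pair of its ends, so \<open>g\<close> determines the
    arc map.\<close>
  define g where "g = the_inv_into (pverts F) f"
  define h where "h = \<lparr>iso_verts = g, iso_arcs = map_prod g g, iso_head = snd, iso_tail = fst\<rparr>"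
  have gf: "g (f i) = i" if "i \<in> pverts F" for i
    using inj that by (simp add: g_def the_inv_into_f_f)
  have fg: "f (g x) = x" "g x \<in> pverts F" if "x \<in> pverts G" for x
    using that verts gf by force+
  have inj_g: "inj_on g (pverts G)"
    by (metis fg(1) inj_on_def)
  have "inj_on (map_prod g g) (parcs G)"
    by (rule inj_on_subset[OF map_prod_inj_on[OF inj_g inj_g]]) (auto dest: G.in_arcsD1 G.in_arcsD2)
  then have "pre_digraph.digraph_isomorphism (with_proj G) h"
    unfolding pre_digraph.digraph_isomorphism_def using inj_g assms(1)
    by (auto simp: h_def wf_digraph_wp_iff)
  moreover have "with_proj F = app_iso h (with_proj G)"
  proof (rule pre_digraph.equality)
    show "verts (with_proj F) = verts (app_iso h (with_proj G))"
      using gf fg verts by (force simp: h_def)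
    have "(i, j) \<in> map_prod g g ` parcs G" if "(i, j) \<in> parcs F" for i j
    proof -
      have "i \<in> pverts F" "j \<in> pverts F" using that by (auto dest: F.in_arcsD1 F.in_arcsD2)
      then show ?thesis using that arcs gf by (intro rev_image_eqI[of "(f i, f j)"]) auto
    qed
    moreover have "(g x, g y) \<in> parcs F" if "(x, y) \<in> parcs G" for x y
      using that arcs[of "g x" "g y"] fg G.in_arcsD1[OF that] G.in_arcsD2[OF that] by simp
    ultimately show "arcs (with_proj F) = arcs (app_iso h (with_proj G))"
      by (auto simp: h_def)
  qed (simp_all add: h_def)
  ultimately show ?thesis
    unfolding digraph_iso_def by blast
qed

text \<open>The subgraph of \<open>G\<close> induced by the image of \<open>f\<close> is a copy of
  \<open>F\<close>. Finding a forbidden graph thus amounts to naming its vertices and checking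
  adjacencies.\<close>

lemma induced_freeD:
  fixes F :: "'b pair_pre_digraph" and G :: "'a pair_pre_digraph"
  assumes "induced_free G F" "pair_wf_digraph G" "pair_wf_digraph F"
    and inj: "inj_on f (pverts F)" and verts: "f ` pverts F \<subseteq> pverts G"
    and arcs: "\<And>i j. i \<in> pverts F \<Longrightarrow> j \<in> pverts F \<Longrightarrow> (f i, f j) \<in> parcs G \<longleftrightarrow> (i, j) \<in> parcs F"
  shows False
proof -
  define H where "H = \<lparr>pverts = f ` pverts F, parcs = parcs G \<inter> (f ` pverts F) \<times> (f ` pverts F)\<rparr>"
  have "pair_wf_digraph H"
    by unfold_locales (auto simp: H_def)
  moreover from this have "induced_subgraph (with_proj H) (with_proj G)"
    using assms(2) verts
    by (auto simp: H_def induced_subgraph_def subgraph_def wf_digraph_wp_iff)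
  moreover have "digraph_iso (with_proj H) (with_proj F)"
    using \<open>pair_wf_digraph H\<close> assms(3) inj
    by (rule digraph_isoI) (auto simp: H_def arcs)
  ultimately show False
    using assms(1) unfolding induced_free_def by blast
qed

lemma pair_graph_wf: "pair_graph G \<Longrightarrow> pair_wf_digraph G"
  by (simp add: pair_graph.axioms(1) pair_digraph.axioms(1) pair_fin_digraph.axioms(1))

lemma pverts_graph_join: "pverts (graph_join A B) = pverts A <+> pverts B"
  and parcs_graph_join:
    "(Inl i, Inl i') \<in> parcs (graph_join A B) \<longleftrightarrow> (i, i') \<in> parcs A"
    "(Inr j, Inr j') \<in> parcs (graph_join A B) \<longleftrightarrow> (j, j') \<in> parcs B"
    "(Inl i, Inr j) \<in> parcs (graph_join A B) \<longleftrightarrow> i \<in> pverts A \<and> j \<in> pverts B"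
    "(Inr j, Inl i) \<in> parcs (graph_join A B) \<longleftrightarrow> i \<in> pverts A \<and> j \<in> pverts B"
  by (auto simp: graph_join_def disjoint_union_def)

lemma pverts_disjoint_union: "pverts (disjoint_union A B) = pverts A <+> pverts B"
  and parcs_disjoint_union:
    "(Inl i, Inl i') \<in> parcs (disjoint_union A B) \<longleftrightarrow> (i, i') \<in> parcs A"
    "(Inr j, Inr j') \<in> parcs (disjoint_union A B) \<longleftrightarrow> (j, j') \<in> parcs B"
    "(Inl i, Inr j) \<notin> parcs (disjoint_union A B)"
    "(Inr j, Inl i) \<notin> parcs (disjoint_union A B)"
  by (auto simp: disjoint_union_def)

lemmas graph_operation_simps = pverts_graph_join parcs_graph_join
  pverts_disjoint_union parcs_disjoint_union complete_graph_def path_graph_def graph_complement_def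

lemma lessThan_numerals:
  "{..<Suc 0} = {0}" "{..<2::nat} = {0, 1}" "{..<3::nat} = {0, 1, 2}" "{..<4::nat} = {0, 1, 2, 3}"
  by auto

text \<open>Symmetric arcs make the symmetric closure in the definition of connectedness harmless,
  and a walk that starts in \<open>S\<close> never leaves it.\<close>

lemma connected_closed_set:
  assumes "connected H" "sym (arcs_ends H)" "a \<in> verts H" "a \<in> S"
    and step: "\<And>x y. x \<in> S \<Longrightarrow> (x, y) \<in> arcs_ends H \<Longrightarrow> y \<in> S"
  shows "verts H \<subseteq> S"
proof
  fix b assume "b \<in> verts H"
  have "(arcs_ends H)\<^sup>s = arcs_ends H"
    using assms(2) by (auto simp: symcl_def sym_def)
  then have "(a, b) \<in> rtrancl_on (verts H) (arcs_ends H)"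
    using assms(1,3) \<open>b \<in> verts H\<close> by (simp add: connected_conv)
  then show "b \<in> S"
    by (induction rule: rtrancl_on_induct) (use \<open>a \<in> S\<close> step in auto)
qed

section \<open>Cycles as lists of distinct vertices\<close>

lemma pcas_zip_successive: "pcas u (zip (u # ws) ws) (last (u # ws))"
  by (induction ws arbitrary: u) auto

lemma set_zip_successive_subset:
  "successively (\<lambda>x y. (x, y) \<in> A) (u # ws) \<longleftrightarrow> set (zip (u # ws) ws) \<subseteq> A"
  by (induction ws arbitrary: u) auto

lemma pcas_eq_zip: "pcas u p v \<Longrightarrow> p = zip (u # map snd p) (map snd p) \<and> last (u # map snd p) = v"
  by (induction p arbitrary: u) auto

lemma pawalk_verts_pcas: "pcas u p v \<Longrightarrow> pawalk_verts u p = u # map snd p"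
  by (induction p arbitrary: u) auto

text \<open>Appending \<open>hd vs\<close> supplies the closing edge. Vertex lists, unlike arc
  lists, can be cut, reversed and pasted when a cycle is rerouted.\<close>

definition vertex_cycle :: "'a pair_pre_digraph \<Rightarrow> 'a list \<Rightarrow> bool" where
  "vertex_cycle G vs \<longleftrightarrow> distinct vs \<and> 3 \<le> length vs \<and>
     successively (\<lambda>x y. (x, y) \<in> parcs G) (vs @ [hd vs])"

lemma graph_cycle_of_vertex_cycle:
  assumes "pair_wf_digraph G" "vertex_cycle G vs"
  shows "\<exists>C. graph_cycle G C \<and> cycle_verts C = set vs"
proof -
  interpret pair_wf_digraph G by fact
  obtain u ws where vs: "vs = u # ws"
    using assms(2) by (cases vs) (auto simp: vertex_cycle_def)
  let ?ws = "ws @ [u]"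
  let ?C = "zip (u # ?ws) ?ws"
  have arcs: "set ?C \<subseteq> parcs G"
    using assms(2) by (simp add: vertex_cycle_def vs flip: set_zip_successive_subset)
  have cas: "pcas u ?C u"
    using pcas_zip_successive[of u ?ws] by simp
  have snd: "map snd ?C = ?ws"
    by (simp add: map_snd_zip_take)
  have "u \<in> pverts G"
    using arcs by (cases ws) (auto dest: in_arcsD1)
  moreover have "distinct (tl (pawalk_verts u ?C))"
    using assms(2) snd by (simp add: pawalk_verts_pcas[OF cas] vertex_cycle_def vs)
  ultimately have "cycle ?C"
    unfolding cycle_def awalk_def using arcs cas by (intro exI[of _ u]) auto
  moreover have "map fst ?C = u # ws"
    by (simp add: map_fst_zip_take)
  then have "cycle_verts ?C = set vs"
    unfolding cycle_verts_def by (metis list.set_map vs)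
  ultimately show ?thesis
    using assms(2) by (intro exI[of _ ?C]) (auto simp: graph_cycle_def vertex_cycle_def vs)
qed

lemma vertex_cycle_of_graph_cycle:
  assumes "graph_cycle G C"
  obtains vs where "vertex_cycle G vs" "set vs = cycle_verts C"
proof -
  obtain u where C: "pcas u C u" "set C \<subseteq> parcs G" "distinct (tl (pawalk_verts u C))" "3 \<le> length C"
    using assms by (auto simp: graph_cycle_def pre_digraph.cycle_def pre_digraph.awalk_def
        cas_with_proj_eq awalk_verts_with_proj_eq)
  define ws where "ws = map snd C"
  have Cz: "C = zip (u # ws) ws" "last (u # ws) = u"
    using pcas_eq_zip[OF C(1)] by (auto simp: ws_def)
  have "ws \<noteq> []" using C(4) by (auto simp: ws_def)
  \<comment> \<open>The heads of a closed walk end in its start \<open>u\<close>; moving this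
    \<open>u\<close> to the front turns the list of heads into the list of tails.\<close>
  with Cz(2) obtain xs where ws: "ws = xs @ [u]"
    by (metis append_butlast_last_id last_ConsR)
  have "distinct (u # xs)"
    using C(3) by (simp add: pawalk_verts_pcas[OF C(1)] ws flip: ws_def)
  moreover have "successively (\<lambda>x y. (x, y) \<in> parcs G) (u # xs @ [u])"
    using C(2) Cz(1) unfolding ws by (metis set_zip_successive_subset)
  moreover have "length (u # xs) = length C"
    using ws by (metis length_map length_append_singleton length_Cons ws_def)
  ultimately have "vertex_cycle G (u # xs)"
    using C(4) by (simp add: vertex_cycle_def)
  moreover have "map fst C = u # xs"
    by (subst Cz(1)) (simp add: ws map_fst_zip_take)
  then have "set (u # xs) = cycle_verts C"
    unfolding cycle_verts_def by (metis list.set_map)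
  ultimately show thesis by (rule that)
qed

text \<open>Lets any vertex of a cycle become the first one, so that later arguments may always
  start at the vertex of interest.\<close>

lemma vertex_cycle_rotate:
  "vertex_cycle G (xs @ ys) \<Longrightarrow> vertex_cycle G (ys @ xs)"
  by (cases xs; cases ys) (auto simp: vertex_cycle_def successively_append_iff successively_Cons hd_append)

text \<open>Formulated for the vertex set alone, so that it is unaffected by rotating the
  cycle.\<close>

definition extensible :: "'a pair_pre_digraph \<Rightarrow> 'a set \<Rightarrow> bool" where
  "extensible G S \<longleftrightarrow> (\<exists>vs. vertex_cycle G vs \<and> S \<subseteq> set vs \<and> length vs = Suc (card S))"

text \<open>A rerouted cycle is a rearrangement of the old vertices and \<open>x\<close>; comparing
  multisets settles containment and length at once.\<close>

lemma extensible_if_mset_eq: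
  assumes "vertex_cycle G vs" "mset vs = mset (x # us)" "distinct us"
  shows "extensible G (set us)"
  using assms(1) mset_eq_setD[OF assms(2)] mset_eq_length[OF assms(2)] distinct_card[OF assms(3)]
  by (auto simp: extensible_def)

lemma extendable_if_extensible:
  assumes "pair_wf_digraph G" "extensible G (cycle_verts C)"
  shows "extendable G C"
proof -
  obtain vs where vs: "vertex_cycle G vs" "cycle_verts C \<subseteq> set vs"
      "length vs = Suc (card (cycle_verts C))"
    using assms(2) by (auto simp: extensible_def)
  obtain C' where "graph_cycle G C'" "cycle_verts C' = set vs"
    using graph_cycle_of_vertex_cycle[OF assms(1) vs(1)] by blast
  then show ?thesis
    using vs distinct_card[of vs] unfolding extendable_def
    by (intro exI[of _ C']) (simp add: vertex_cycle_def)
qed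

section \<open>Forbidden subgraphs as adjacency patterns\<close>

lemma K1_join_P4_induced:
  assumes G: "pair_graph G" and free: "induced_free G K1_join_P4"
    and "(c, a) \<in> parcs G" "(c, b) \<in> parcs G" "(c, d) \<in> parcs G" "(c, e) \<in> parcs G"
    and "(a, b) \<in> parcs G" "(b, d) \<in> parcs G" "(d, e) \<in> parcs G"
    and "(a, d) \<notin> parcs G" "(a, e) \<notin> parcs G" "(b, e) \<notin> parcs G"
  shows False
proof (rule induced_freeD[OF free pair_graph_wf[OF G] pair_graph_wf])
  interpret pair_graph G by fact
  let ?f = "case_sum (\<lambda>_. c) (\<lambda>i. [a, b, d, e] ! i) :: nat + nat \<Rightarrow> 'a"
  have neg: "(d, a) \<notin> parcs G" "(e, a) \<notin> parcs G" "(e, b) \<notin> parcs G"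
    "(x, x) \<notin> parcs G" for x
    using assms arcs_symmetric no_loops' by blast+
  note pos = assms(3-9) assms(3-9)[THEN arcs_symmetric]
  \<comment> \<open>Any two of these vertices are adjacent or are told apart by a third one adjacent
    to exactly one of them.\<close>
  have dist: "distinct [c, a, b, d, e]"
    using pos neg assms by auto
  show "pair_graph K1_join_P4"
    unfolding K1_join_P4_def by (intro pair_graph_join pair_graph_complete_graph pair_graph_path_graph)
  show "inj_on ?f (pverts K1_join_P4)"
    using dist by (auto simp: K1_join_P4_def graph_operation_simps lessThan_numerals Plus_def)
  show "?f ` pverts K1_join_P4 \<subseteq> pverts G"
    using pos by (auto simp: K1_join_P4_def graph_operation_simps lessThan_numerals Plus_def dest: in_arcsD2)
  fix i j assume "i \<in> pverts K1_join_P4" "j \<in> pverts K1_join_P4"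
  then show "(?f i, ?f j) \<in> parcs G \<longleftrightarrow> (i, j) \<in> parcs K1_join_P4"
    using pos neg assms(10-)
    by (auto simp: K1_join_P4_def graph_operation_simps lessThan_numerals)
qed

text \<open>The leaves have identical adjacencies in the pattern, so here their distinctness has to
  be assumed.\<close>

lemma K14_induced:
  assumes G: "pair_graph G" and free: "induced_free G K14"
    and "(c, a) \<in> parcs G" "(c, b) \<in> parcs G" "(c, d) \<in> parcs G" "(c, e) \<in> parcs G"
    and "distinct [a, b, d, e]"
    and "(a, b) \<notin> parcs G" "(a, d) \<notin> parcs G" "(a, e) \<notin> parcs G"
    and "(b, d) \<notin> parcs G" "(b, e) \<notin> parcs G" "(d, e) \<notin> parcs G"
  shows False
proof (rule induced_freeD[OF free pair_graph_wf[OF G] pair_graph_wf])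
  interpret pair_graph G by fact
  let ?f = "case_sum (\<lambda>_. c) (\<lambda>i. [a, b, d, e] ! i) :: nat + nat \<Rightarrow> 'a"
  have neg: "(b, a) \<notin> parcs G" "(d, a) \<notin> parcs G" "(e, a) \<notin> parcs G"
    "(d, b) \<notin> parcs G" "(e, b) \<notin> parcs G" "(e, d) \<notin> parcs G" "(x, x) \<notin> parcs G" for x
    using assms arcs_symmetric no_loops' by blast+
  note pos = assms(3-6) assms(3-6)[THEN arcs_symmetric]
  have dist: "distinct [c, a, b, d, e]"
    using pos neg assms(7) by auto
  show "pair_graph K14"
    unfolding K14_def by (intro pair_graph_join pair_graph_complete_graph pair_graph_complement)
  show "inj_on ?f (pverts K14)"
    using dist by (auto simp: K14_def graph_operation_simps lessThan_numerals Plus_def)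
  show "?f ` pverts K14 \<subseteq> pverts G"
    using pos by (auto simp: K14_def graph_operation_simps lessThan_numerals Plus_def dest: in_arcsD2)
  fix i j assume "i \<in> pverts K14" "j \<in> pverts K14"
  then show "(?f i, ?f j) \<in> parcs G \<longleftrightarrow> (i, j) \<in> parcs K14"
    using pos neg assms(8-)
    by (auto simp: K14_def graph_operation_simps lessThan_numerals)
qed

text \<open>The edge \<open>cd\<close> is the joined K2, \<open>x\<close> the isolated vertex and
  \<open>yz\<close> the remaining edge.\<close>

lemma K2_join_K1_K2_induced:
  assumes G: "pair_graph G" and free: "induced_free G K2_join_K1_K2"
    and "(c, d) \<in> parcs G"
    and "(c, x) \<in> parcs G" "(c, y) \<in> parcs G" "(c, z) \<in> parcs G"
    and "(d, x) \<in> parcs G" "(d, y) \<in> parcs G" "(d, z) \<in> parcs G"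
    and "(y, z) \<in> parcs G"
    and "(x, y) \<notin> parcs G" "(x, z) \<notin> parcs G"
  shows False
proof (rule induced_freeD[OF free pair_graph_wf[OF G] pair_graph_wf])
  interpret pair_graph G by fact
  let ?f = "case_sum (\<lambda>i. [c, d] ! i) (case_sum (\<lambda>_. x) (\<lambda>i. [y, z] ! i)) :: nat + (nat + nat) \<Rightarrow> 'a"
  have neg: "(y, x) \<notin> parcs G" "(z, x) \<notin> parcs G" "(w, w) \<notin> parcs G" for w
    using assms arcs_symmetric no_loops' by blast+
  note pos = assms(3-10) assms(3-10)[THEN arcs_symmetric]
  have dist: "distinct [c, d, x, y, z]"
    using pos neg assms(11-) by auto
  show "pair_graph K2_join_K1_K2"
    unfolding K2_join_K1_K2_def
    by (intro pair_graph_join pair_graph_complete_graph pair_graph_disjoint_union)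
  show "inj_on ?f (pverts K2_join_K1_K2)"
    using dist by (auto simp: K2_join_K1_K2_def graph_operation_simps lessThan_numerals Plus_def)
  show "?f ` pverts K2_join_K1_K2 \<subseteq> pverts G"
    using pos by (auto simp: K2_join_K1_K2_def graph_operation_simps lessThan_numerals Plus_def dest: in_arcsD2)
  fix i j assume "i \<in> pverts K2_join_K1_K2" "j \<in> pverts K2_join_K1_K2"
  then show "(?f i, ?f j) \<in> parcs G \<longleftrightarrow> (i, j) \<in> parcs K2_join_K1_K2"
    using pos neg assms(11-)
    by (auto simp: K2_join_K1_K2_def graph_operation_simps lessThan_numerals)
qed

lemma digraph_iso_K113:
  assumes G: "pair_graph G" and verts: "pverts G = {u, v, a, b, x}" and dist: "distinct [a, b, x]"
    and "(u, v) \<in> parcs G" "(u, a) \<in> parcs G" "(u, b) \<in> parcs G" "(u, x) \<in> parcs G"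
    and "(v, a) \<in> parcs G" "(v, b) \<in> parcs G" "(v, x) \<in> parcs G"
    and "(a, b) \<notin> parcs G" "(a, x) \<notin> parcs G" "(b, x) \<notin> parcs G"
  shows "digraph_iso (with_proj G) (with_proj K113)"
proof (rule digraph_isoI[OF pair_graph_wf[OF G] pair_graph_wf])
  interpret pair_graph G by fact
  let ?f = "case_sum (case_sum (\<lambda>_. u) (\<lambda>_. v)) (\<lambda>i. [a, b, x] ! i) :: (nat + nat) + nat \<Rightarrow> 'a"
  have neg: "(b, a) \<notin> parcs G" "(x, a) \<notin> parcs G" "(x, b) \<notin> parcs G" "(w, w) \<notin> parcs G" for w
    using assms arcs_symmetric no_loops' by blast+
  note pos = assms(4-10) assms(4-10)[THEN arcs_symmetric]
  have dist': "distinct [u, v, a, b, x]"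
    using pos neg dist by auto
  show "pair_graph K113"
    unfolding K113_def
    by (intro pair_graph_join pair_graph_complete_graph pair_graph_complement)
  show "inj_on ?f (pverts K113)"
    using dist' by (auto simp: K113_def graph_operation_simps lessThan_numerals Plus_def)
  show "?f ` pverts K113 = pverts G"
    by (auto simp: K113_def graph_operation_simps lessThan_numerals Plus_def verts)
  fix i j assume "i \<in> pverts K113" "j \<in> pverts K113"
  then show "(?f i, ?f j) \<in> parcs G \<longleftrightarrow> (i, j) \<in> parcs K113"
    using pos neg assms(11-)
    by (auto simp: K113_def graph_operation_simps lessThan_numerals)
qed

section \<open>Neighborhoods under the local hypotheses\<close>

locale forbidden_free_graph = pair_graph G for G :: "'a pair_pre_digraph" +
  assumes locally_connected: "locally_connected G"
    and K1_join_P4_free: "induced_free G K1_join_P4"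
    and K14_free: "induced_free G K14"
    and K2_join_K1_K2_free: "induced_free G K2_join_K1_K2"
begin

abbreviation adj :: "'a \<Rightarrow> 'a \<Rightarrow> bool" (infix "\<sim>" 50) where
  "a \<sim> b \<equiv> (a, b) \<in> parcs G"

abbreviation nadj :: "'a \<Rightarrow> 'a \<Rightarrow> bool" (infix "\<nsim>" 50) where
  "a \<nsim> b \<equiv> (a, b) \<notin> parcs G"

lemma adj_commute: "a \<sim> b \<longleftrightarrow> b \<sim> a"
  using arcs_symmetric by blast

lemma not_adj_self [simp]: "a \<nsim> a"
  using no_loops' by blast

lemmas no_K1_join_P4 = K1_join_P4_induced[OF pair_graph K1_join_P4_free]
  and no_K14 = K14_induced[OF pair_graph K14_free]
  and no_K2_join_K1_K2 = K2_join_K1_K2_induced[OF pair_graph K2_join_K1_K2_free]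

text \<open>The form in which local connectedness is applied: the closure principle inside the
  subgraph induced by N(u).\<close>

lemma neighborhood_closed_set:
  assumes "u \<sim> a" "a \<in> S"
    and step: "\<And>x y. x \<in> S \<Longrightarrow> u \<sim> x \<Longrightarrow> u \<sim> y \<Longrightarrow> x \<sim> y \<Longrightarrow> y \<in> S"
    and "u \<sim> b"
  shows "b \<in> S"
proof -
  let ?H = "with_proj G \<restriction> neighborhood G u"
  have arcs: "arcs_ends ?H = {(x, y). x \<sim> y \<and> u \<sim> x \<and> u \<sim> y}"
    by (auto simp: arcs_ends_conv induce_subgraph_def neighborhood_def)
  have verts: "verts ?H = neighborhood G u"
    by (simp add: induce_subgraph_def)
  have "connected ?H"
    using locally_connected in_arcsD1[OF assms(1)] by (simp add: locally_connected_def)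
  moreover have "sym (arcs_ends ?H)"
    using arcs_symmetric by (auto simp: arcs sym_def)
  moreover have "a \<in> verts ?H"
    unfolding verts using assms(1) by (simp add: neighborhood_def)
  ultimately have "verts ?H \<subseteq> S"
    using \<open>a \<in> S\<close> by (rule connected_closed_set) (auto simp: arcs intro: step)
  then show ?thesis
    unfolding verts using assms(4) by (auto simp: neighborhood_def)
qed

text \<open>The vertices within distance two of \<open>x\<close> in N(u) are closed under adjacency
  there: a first vertex \<open>z\<close> at distance three would end an induced path x, v, w, z,
  which with \<open>u\<close> forms K1 + P4.\<close>

lemma neighborhood_distance_le_two:
  assumes "u \<sim> x" "u \<sim> y" "x \<noteq> y" "x \<nsim> y"
  obtains w where "u \<sim> w" "x \<sim> w" "w \<sim> y"
proof -
  let ?S = "{y. y = x \<or> x \<sim> y \<or> (\<exists>w. u \<sim> w \<and> x \<sim> w \<and> w \<sim> y)}"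
  have "y \<in> ?S"
    using assms(1) _ _ assms(2)
  proof (rule neighborhood_closed_set)
    fix w z assume "w \<in> ?S" and w: "u \<sim> w" "u \<sim> z" "w \<sim> z"
    then consider "w = x" | "x \<sim> w" | v where "u \<sim> v" "x \<sim> v" "v \<sim> w"
      by blast
    then show "z \<in> ?S"
    proof cases
      case 3
      then show ?thesis
        using no_K1_join_P4[of u x v w z] w assms(1) by blast
    qed (use w in auto)
  qed simp
  then show thesis
    using that assms by blast
qed

lemma common_neighbor_in_neighborhood:
  assumes "u \<sim> x" "u \<sim> a" "u \<sim> b" "x \<noteq> a" "x \<nsim> a" "x \<noteq> b" "x \<nsim> b"
  obtains w where "u \<sim> w" "w \<sim> x" "w \<sim> a" "w \<sim> b"
proof -
  obtain y where y: "u \<sim> y" "x \<sim> y" "y \<sim> a"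
    using neighborhood_distance_le_two[of u x a] assms by blast
  obtain z where z: "u \<sim> z" "x \<sim> z" "z \<sim> b"
    using neighborhood_distance_le_two[of u x b] assms by blast
  have "y \<sim> b \<or> z \<sim> a"
  proof (rule ccontr)
    assume "\<not> (y \<sim> b \<or> z \<sim> a)"
    then have n: "y \<nsim> b" "z \<nsim> a" by auto
    \<comment> \<open>With hub \<open>u\<close>, the induced P4 is x, y, a, b in the first case, a,
      y, z, b in the second and a, y, x, z in the third.\<close>
    consider "a \<sim> b" | "a \<nsim> b" "y \<sim> z" | "a \<nsim> b" "y \<nsim> z" by blast
    then show False
    proof cases
      case 1
      then show False
        using no_K1_join_P4[of u x y a b] assms y n by blast
    next
      case 2
      then show False
        using no_K1_join_P4[of u a y z b] assms y z n adj_commute by blast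
    next
      case 3
      then show False
        using no_K1_join_P4[of u a y x z] assms y z n adj_commute by blast
    qed
  qed
  then show thesis
    using that y z adj_commute by blast
qed

section \<open>Rerouting a cycle through an outside vertex\<close>

lemma successively_adj_rev: "successively (\<sim>) (rev xs) = successively (\<sim>) xs"
  by (simp add: adj_commute)

text \<open>In the cyclic order \<open>hd ws\<close> follows \<open>u\<close> and
  \<open>last ws\<close> precedes it; were \<open>x\<close> adjacent to one of them, it could be
  inserted between that vertex and \<open>u\<close>.\<close>

lemma vertex_cycle_insert:
  assumes "vertex_cycle G (u # ws)" "x \<notin> set (u # ws)" "\<not> extensible G (set (u # ws))"
    and "u \<sim> x"
  shows "x \<nsim> hd ws" "x \<nsim> last ws"
proof -
  have dist: "distinct (u # ws)" "2 \<le> length ws" and [simp]: "ws \<noteq> []"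
    and succ: "successively (\<sim>) ws" "u \<sim> hd ws" "last ws \<sim> u"
    using assms(1)
    by (auto simp: vertex_cycle_def successively_append_iff successively_Cons hd_append split: if_splits)
  have ext: "\<not> vertex_cycle G vs" if "mset vs = mset (x # u # ws)" for vs
    using extensible_if_mset_eq[OF _ that] dist assms(3) by blast
  show "x \<nsim> hd ws"
  proof
    assume "x \<sim> hd ws"
    then have "vertex_cycle G (u # x # ws)"
      using dist succ assms(2,4)
      by (auto simp: vertex_cycle_def successively_append_iff successively_Cons)
    then show False using ext by simp
  qed
  show "x \<nsim> last ws"
  proof
    assume "x \<sim> last ws"
    then have "vertex_cycle G (u # ws @ [x])"
      using dist succ assms(2,4)
      by (auto simp: vertex_cycle_def successively_append_iff successively_Cons hd_append adj_commute)
    then show False using ext by simp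
  qed
qed

text \<open>An edge between the successors \<open>hd p\<close> and \<open>hd q\<close> of
  \<open>u\<close> and \<open>v\<close> would allow the cycle u, x, v, then \<open>p\<close>
  backwards, then \<open>q\<close>. For the predecessors \<open>last p\<close> and
  \<open>last q\<close> it is u, x, v, then \<open>q\<close>, then \<open>p\<close>
  backwards.\<close>

lemma vertex_cycle_cross:
  assumes "vertex_cycle G (u # p @ v # q)" "x \<notin> set (u # p @ v # q)"
    and "\<not> extensible G (set (u # p @ v # q))"
    and "u \<sim> x" "v \<sim> x" "p \<noteq> []" "q \<noteq> []"
  shows "hd p \<nsim> hd q" "last p \<nsim> last q"
proof -
  have dist: "distinct (u # p @ v # q)"
    and succ: "successively (\<sim>) p" "successively (\<sim>) q"
      "u \<sim> hd p" "last p \<sim> v" "v \<sim> hd q" "last q \<sim> u"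
    using assms(1,6,7)
    by (auto simp: vertex_cycle_def successively_append_iff successively_Cons hd_append)
  have ext: "\<not> vertex_cycle G vs" if "mset vs = mset (x # u # p @ v # q)" for vs
    using extensible_if_mset_eq[OF _ that] dist assms(3) by blast
  show "hd p \<nsim> hd q"
  proof
    assume "hd p \<sim> hd q"
    then have "vertex_cycle G (u # x # v # rev p @ q)"
      using dist succ assms(2,4-7)
      by (auto simp: vertex_cycle_def successively_append_iff successively_Cons hd_append
          hd_rev last_rev successively_adj_rev adj_commute simp del: successively_rev)
    then show False using ext by simp
  qed
  show "last p \<nsim> last q"
  proof
    assume "last p \<sim> last q"
    then have "vertex_cycle G (u # x # v # q @ rev p)"
      using dist succ assms(2,4-7)
      by (auto simp: vertex_cycle_def successively_append_iff successively_Cons hd_append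
          hd_rev last_rev successively_adj_rev adj_commute simp del: successively_rev)
    then show False using ext by simp
  qed
qed

section \<open>Structure of a nonextensible cycle\<close>

lemma attached_vertex_chord:
  assumes cyc: "vertex_cycle G (u # ws)" and x: "x \<notin> set (u # ws)"
    and ext: "\<not> extensible G (set (u # ws))" and ux: "u \<sim> x"
  shows "hd ws \<nsim> last ws" (is ?nadj)
    and "\<exists>p v q. ws = p @ v # q \<and> p \<noteq> [] \<and> q \<noteq> [] \<and>
       u \<sim> v \<and> v \<sim> x \<and> v \<sim> hd ws \<and> v \<sim> last ws" (is ?chord)
proof -
  have [simp]: "ws \<noteq> []" and succ: "u \<sim> hd ws" "last ws \<sim> u"
    using cyc
    by (auto simp: vertex_cycle_def successively_append_iff successively_Cons hd_append split: if_splits)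
  have in_ws: "hd ws \<in> set ws" "last ws \<in> set ws" by auto
  note xn = vertex_cycle_insert[OF cyc x ext ux]
  obtain v where v: "u \<sim> v" "v \<sim> x" "v \<sim> hd ws" "v \<sim> last ws"
    using common_neighbor_in_neighborhood[of u x "hd ws" "last ws"] ux succ xn x in_ws adj_commute
    by (metis list.set_intros(2))
  \<comment> \<open>Otherwise the edge between the cycle neighbors of \<open>u\<close>, together
    with \<open>x\<close> and the edge \<open>uv\<close>, induces K2 + (K1 u K2).\<close>
  show ?nadj
    using no_K2_join_K1_K2[of u v x "hd ws" "last ws"] v ux succ xn adj_commute by blast
  have "v \<noteq> u" using v by auto
  \<comment> \<open>A vertex \<open>v\<close> off the cycle would be adjacent to both
    \<open>u\<close> and \<open>hd ws\<close>, and could be inserted there.\<close>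
  moreover have "v \<in> set (u # ws)"
    using vertex_cycle_insert(1)[OF cyc _ ext v(1)] v(3) by blast
  ultimately obtain p q where ws: "ws = p @ v # q"
    by (auto dest: split_list)
  moreover have "p \<noteq> []" "q \<noteq> []"
    using v ws by auto
  ultimately show ?chord
    using v by blast
qed

lemma nonextensible_cycle_is_C4:
  assumes cyc: "vertex_cycle G (u # ws)" and x: "x \<notin> set (u # ws)"
    and ext: "\<not> extensible G (set (u # ws))" and ux: "u \<sim> x"
  shows "\<exists>a v b. ws = [a, v, b] \<and> u \<sim> v \<and> v \<sim> x \<and> a \<nsim> b \<and> x \<nsim> a \<and> x \<nsim> b"
proof -
  obtain p v q where ws: "ws = p @ v # q" and ne: "p \<noteq> []" "q \<noteq> []"
    and v: "u \<sim> v" "v \<sim> x" "v \<sim> hd ws" "v \<sim> last ws"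
    using attached_vertex_chord(2)[OF assms] by blast
  \<comment> \<open>In cyclic order the cycle reads u, a, ..., a', v, b', ..., b. The goal is
    \<open>a = a'\<close> and \<open>b = b'\<close>.\<close>
  define a a' b' b where abs: "a = hd p" "a' = last p" "b' = hd q" "b = last q"
  have ends: "hd ws = a" "last ws = b" using ne by (auto simp: ws abs)
  have "vertex_cycle G (u # p @ v # q)" using cyc ws by simp
  then have dist: "distinct (u # p @ v # q)"
    and succ: "u \<sim> a" "a' \<sim> v" "v \<sim> b'" "b \<sim> u"
    using ne by (auto simp: abs vertex_cycle_def successively_append_iff successively_Cons hd_append)
  have mem: "a \<in> set p" "a' \<in> set p" "b' \<in> set q" "b \<in> set q"
    using ne by (auto simp: abs)
  \<comment> \<open>Since \<open>v\<close> is also adjacent to \<open>x\<close>, the facts proved at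
    \<open>u\<close> hold at \<open>v\<close> after rotation.\<close>
  have cyc': "vertex_cycle G (v # q @ u # p)"
    using vertex_cycle_rotate[of G "u # p" "v # q"] cyc ws by simp
  have set': "set (v # q @ u # p) = set (u # ws)" by (auto simp: ws)
  have x': "x \<notin> set (v # q @ u # p)" and ext': "\<not> extensible G (set (v # q @ u # p))"
    using x ext unfolding set' by auto
  have ab: "a \<nsim> b" "x \<nsim> a" "x \<nsim> b"
    using attached_vertex_chord(1)[OF assms] vertex_cycle_insert[OF assms] by (auto simp: ends)
  have ab': "b' \<nsim> a'" "x \<nsim> b'" "x \<nsim> a'"
    using attached_vertex_chord(1)[OF cyc' x' ext' v(2)] vertex_cycle_insert[OF cyc' x' ext' v(2)] ne
    by (auto simp: abs)
  have cross: "a \<nsim> b'" "a' \<nsim> b"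
    using vertex_cycle_cross[of u p v q x] cyc x ext ux v ne by (auto simp: ws abs)
  have xnot: "x \<noteq> a" "x \<noteq> b" "x \<noteq> a'" "x \<noteq> b'" "a \<noteq> b" "a \<noteq> b'" "a' \<noteq> b" "a' \<noteq> b'"
    using x dist mem by (auto simp: ws)
  have va: "v \<sim> a" "v \<sim> b" using v by (auto simp: ends)
  \<comment> \<open>Otherwise \<open>x\<close>, \<open>a\<close>, \<open>b\<close>,
    \<open>b'\<close> are the leaves of an induced K1,4 centered at \<open>v\<close>.\<close>
  have "b = b' \<or> b' \<sim> b"
    using no_K14[of v x a b b'] ab ab' cross va v succ xnot adj_commute by auto
  \<comment> \<open>If \<open>b'\<close> and \<open>b\<close> are adjacent but \<open>u\<close>
    misses \<open>b'\<close>, then b', b, u, x is an induced path in N(v).\<close>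
  then have ub': "u \<sim> b'"
    using no_K1_join_P4[of v b' b u x] succ adj_commute ab ab' va v ux by blast
  have "a = a' \<or> a' \<sim> a"
    using no_K14[of v x b a a'] ab ab' cross va v succ xnot adj_commute by auto
  then have ua': "u \<sim> a'"
    using no_K1_join_P4[of v a' a u x] succ adj_commute ab ab' va v ux by blast
  \<comment> \<open>An edge between \<open>b\<close> and \<open>b'\<close> would be the K2 beside
    the isolated vertex \<open>a\<close> in the common neighborhood of \<open>u\<close> and
    \<open>v\<close>.\<close>
  have "b' \<nsim> b"
    using no_K2_join_K1_K2[of u v a b b'] ub' succ va v ab cross adj_commute by blast
  then have "b = b'" using \<open>b = b' \<or> b' \<sim> b\<close> by blast
  have "a' \<nsim> a"
    using no_K2_join_K1_K2[of u v b a a'] ua' succ va v ab cross adj_commute by blast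
  then have "a = a'" using \<open>a = a' \<or> a' \<sim> a\<close> by blast
  \<comment> \<open>The first and last vertices of \<open>p\<close> coincide, and likewise for
    \<open>q\<close>, so each segment has just one vertex.\<close>
  have single: "xs = [hd xs]" if "distinct xs" "xs \<noteq> []" "hd xs = last xs" for xs :: "'a list"
    using that by (cases xs) (auto split: if_splits)
  have "p = [a]" "q = [b]"
    using single[of p] single[of q] dist ne \<open>a = a'\<close> \<open>b = b'\<close> by (auto simp: abs)
  then show ?thesis
    using ws v ab by auto
qed

section \<open>From the cycle of length four to K1,1,3\<close>

lemma sym_parcs: "sym (parcs G)"
  using arcs_symmetric by (auto simp: sym_def)

lemma nonextensible_cycle_imp_K113:
  assumes conn: "connected (with_proj G)" and cyc: "vertex_cycle G vs"
    and ext: "\<not> extensible G (set vs)" and t: "t \<in> pverts G" "t \<notin> set vs"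
  shows "digraph_iso (with_proj G) (with_proj K113)"
proof -
  have "hd vs \<in> set vs" "hd vs \<in> pverts G"
    using cyc by (cases vs; cases "tl vs"; auto simp: vertex_cycle_def dest: in_arcsD1)+
  \<comment> \<open>By connectedness some edge leaves the vertex set of the cycle, as
    \<open>t\<close> lies outside it.\<close>
  then obtain u x where ux: "u \<in> set vs" "u \<sim> x" "x \<notin> set vs"
    using connected_closed_set[OF conn, of "hd vs" "set vs"] sym_parcs t by auto
  then obtain p q where vs: "vs = p @ u # q"
    by (auto dest: split_list)
  have "vertex_cycle G (u # q @ p)"
    using vertex_cycle_rotate[of G p "u # q"] cyc vs by simp
  moreover have "set (u # q @ p) = set vs"
    by (auto simp: vs)
  ultimately obtain a v b where avb: "u \<sim> v" "v \<sim> x" "a \<nsim> b" "x \<nsim> a" "x \<nsim> b"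
    and cyc4: "vertex_cycle G [u, a, v, b]" and set4: "set vs = {u, a, v, b}"
    using nonextensible_cycle_is_C4[of u "q @ p" x] ext ux by fastforce
  have ext4: "\<not> extensible G {u, a, v, b}" using ext set4 by simp
  have edges: "u \<sim> a" "a \<sim> v" "v \<sim> b" "b \<sim> u" and "a \<noteq> b" and xC: "x \<notin> {u, a, v, b}"
    using cyc4 ux(3) by (auto simp: vertex_cycle_def set4)
  have cycs: "vertex_cycle G [a, v, b, u]" "vertex_cycle G [v, b, u, a]" "vertex_cycle G [b, u, a, v]"
    using vertex_cycle_rotate[of G "[u]" "[a, v, b]"] vertex_cycle_rotate[of G "[u, a]" "[v, b]"]
      vertex_cycle_rotate[of G "[u, a, v]" "[b]"] cyc4 by auto
  have sets: "set [a, v, b, u] = {u, a, v, b}" "set [v, b, u, a] = {u, a, v, b}"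
    "set [b, u, a, v] = {u, a, v, b}" "set [u, a, v, b] = {u, a, v, b}"
    by auto
  \<comment> \<open>An outside neighbor of \<open>a\<close> would force, by the structure lemma read
    from \<open>a\<close>, an edge to the opposite vertex \<open>b\<close>. The same argument
    applies to \<open>b\<close>.\<close>
  have za: "a \<nsim> z" if "z \<notin> {u, a, v, b}" for z
    using nonextensible_cycle_is_C4[OF cycs(1), unfolded sets, OF that ext4] avb(1) adj_commute by auto
  have zb: "b \<nsim> z" if "z \<notin> {u, a, v, b}" for z
    using nonextensible_cycle_is_C4[OF cycs(3), unfolded sets, OF that ext4] avb(1) by auto
  have zu: "z = x" if "z \<notin> {u, a, v, b}" "u \<sim> z" for z
  proof (rule ccontr)
    assume "z \<noteq> x"
    have z: "v \<sim> z" "z \<nsim> a" "z \<nsim> b"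
      using nonextensible_cycle_is_C4[OF cyc4, unfolded sets, OF that(1) ext4 that(2)] by auto
    \<comment> \<open>K1,4 at \<open>u\<close> with leaves \<open>a\<close>, \<open>b\<close>,
      \<open>x\<close>, \<open>z\<close> forces this edge, which then yields K2 + (K1 u K2) on
      \<open>uv\<close> with isolated vertex \<open>a\<close>.\<close>
    have "x \<sim> z"
      using no_K14[of u a b x z] edges ux(2) that avb z adj_commute \<open>a \<noteq> b\<close> xC \<open>z \<noteq> x\<close> by auto
    then show False
      using no_K2_join_K1_K2[of u v a x z] edges ux(2) that(2) avb z adj_commute by blast
  qed
  have zv: "z = x" if "z \<notin> {u, a, v, b}" "v \<sim> z" for z
    using nonextensible_cycle_is_C4[OF cycs(2), unfolded sets, OF that(1) ext4 that(2)] zu that(1)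
    by auto
  have zC: "z = x" if "z \<notin> {u, a, v, b}" "y \<in> {u, a, v, b}" "y \<sim> z" for y z
    using that za zb zu zv by blast
  \<comment> \<open>N(x) is connected and contains \<open>u\<close>. Leaving the cycle inside N(x)
    would lead to \<open>x\<close> itself, which is not in N(x).\<close>
  have zx: "z \<in> {u, a, v, b}" if "x \<sim> z" for z
  proof (rule neighborhood_closed_set[of x u _ z])
    show "x \<sim> u" using ux(2) adj_commute by blast
    fix y w assume "y \<in> {u, a, v, b}" "x \<sim> w" "y \<sim> w"
    then show "w \<in> {u, a, v, b}"
      using zC[of w y] by (metis not_adj_self)
  qed (use that in auto)
  have "pverts G \<subseteq> {u, v, a, b, x}"
    using connected_closed_set[OF conn, of u "{u, v, a, b, x}"] sym_parcs in_arcsD1[OF ux(2)] zC zx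
    by auto
  then have "pverts G = {u, v, a, b, x}"
    using edges ux(2) by (auto dest: in_arcsD1 in_arcsD2)
  moreover have "distinct [a, b, x]" using \<open>a \<noteq> b\<close> xC by auto
  ultimately show ?thesis
    using avb edges ux(2) adj_commute by (intro digraph_iso_K113[OF pair_graph]) blast+
qed

section \<open>Triangles through every vertex\<close>

lemma vertex_on_triangle:
  assumes conn: "connected (with_proj G)" and card: "card (pverts G) \<ge> 3" and u: "u \<in> pverts G"
  obtains a b where "vertex_cycle G [u, a, b]"
proof -
  have "\<exists>a b. u \<sim> a \<and> u \<sim> b \<and> a \<sim> b"
  proof (rule ccontr)
    assume no: "\<nexists>a b. u \<sim> a \<and> u \<sim> b \<and> a \<sim> b"
    \<comment> \<open>Connectedness of the induced subgraph includes nonemptiness, so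
      \<open>u\<close> is not isolated.\<close>
    have "neighborhood G u \<noteq> {}"
      using locally_connected u by (auto simp: locally_connected_def connected_conv)
    then obtain w where w: "u \<sim> w" by (auto simp: neighborhood_def)
    \<comment> \<open>Without a triangle at \<open>u\<close>, N(u) is connected and edgeless, hence
      a single vertex \<open>w\<close>. Then N(w) is \<open>{u}\<close> as well, leaving only two
      vertices in \<open>G\<close>.\<close>
    have Nu: "y = w" if "u \<sim> y" for y
      using neighborhood_closed_set[of u w "{w}" y] w no that by blast
    have Nw: "y = u" if "w \<sim> y" for y
      using neighborhood_closed_set[of w u "{u}" y] w Nu that adj_commute
      by (metis not_adj_self singletonD singletonI)
    have "pverts G \<subseteq> {u, w}"
      using connected_closed_set[OF conn, of u "{u, w}"] sym_parcs u Nu Nw by auto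
    then have "card (pverts G) \<le> card {u, w}"
      by (intro card_mono) auto
    also have "\<dots> \<le> 2"
      by (simp add: card_insert_if)
    finally show False using card by simp
  qed
  then obtain a b where "u \<sim> a" "u \<sim> b" "a \<sim> b" by blast
  then have "vertex_cycle G [u, a, b]"
    using adj_commute by (auto simp: vertex_cycle_def)
  then show thesis by (rule that)
qed

end

theorem theorem8:
  fixes G :: "'a pair_pre_digraph"
  assumes "pair_graph G"
    and "connected (with_proj G)"
    and "locally_connected G"
    and "induced_free G K1_join_P4"
    and "induced_free G K14"
    and "induced_free G K2_join_K1_K2"
    and "card (pverts G) \<ge> 3"
    and "\<not> digraph_iso (with_proj G) (with_proj K113)"
  shows "fully_cycle_extendable G"
proof -
  interpret forbidden_free_graph G
    using assms by (simp add: forbidden_free_graph_def forbidden_free_graph_axioms_def)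
  show ?thesis
    unfolding fully_cycle_extendable_def
  proof (intro conjI ballI allI impI)
    fix u assume "u \<in> pverts G"
    then obtain a b where "vertex_cycle G [u, a, b]"
      using vertex_on_triangle assms(2,7) by blast
    then obtain T where "graph_cycle G T" "cycle_verts T = set [u, a, b]" "distinct [u, a, b]"
      using graph_cycle_of_vertex_cycle pair_wf_digraph by (metis vertex_cycle_def)
    then show "\<exists>T. graph_cycle G T \<and> card (cycle_verts T) = 3 \<and> u \<in> cycle_verts T"
      by (intro exI[of _ T]) auto
  next
    fix C assume C: "graph_cycle G C \<and> card (cycle_verts C) < card (pverts G)"
    then obtain vs where vs: "vertex_cycle G vs" "set vs = cycle_verts C"
      using vertex_cycle_of_graph_cycle by blast
    have "\<not> pverts G \<subseteq> cycle_verts C"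
      using C card_mono[of "cycle_verts C" "pverts G"] by (auto simp: cycle_verts_def)
    \<comment> \<open>A vertex off the cycle exists, so failure of extensibility would make
      \<open>G\<close> the excluded graph K1,1,3.\<close>
    then have "extensible G (cycle_verts C)"
      using nonextensible_cycle_imp_K113[OF assms(2) vs(1)] vs(2) assms(8) by auto
    then show "extendable G C"
      using extendable_if_extensible pair_wf_digraph by blast
  qed
qed

end
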